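(* For every smooth function $\lambda:\mathbb{R}\to\mathbb{R}$ that is not identically zero, there exist a nonempty smooth manifold $M$, a smooth Riemannian metric $g$ on $M$ and a smooth function $f:M\to\mathbb{R}$ such that the differential $2$-form $$\omega=\lambda(f)\,df\wedge d|\nabla f|^2$$ satisfies $$|\nabla\omega|^2<|\delta\omega|^2$$ on $M$.
   Context: Here $\nabla$ is the Levi-Civita connection of $g$, $\nabla f$ is the gradient of $f$, $|\nabla f|^2=g(\nabla f,\nabla f)$, and $\lambda(f)=\lambda\circ f$. For a differential $2$-form $\omega$, with components $\omega_{jk}$ in an orthonormal frame (so that $df\wedge d|\nabla f|^2$ has components $\nabla_jf\,\nabla_k|\nabla f|^2-\nabla_j|\nabla f|^2\,\nabla_kf$), the norm of the covariant derivative is $|\nabla\omega|^2=\sum_{j<k}\sum_i(\nabla_i\omega_{jk})^2$. The codifferential is the $1$-form $(\delta\omega)_k=-\sum_i\nabla_i\omega_{ik}$, with $|\delta\omega|^2=\sum_k(\delta\omega)_k^2$. *)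

theory Defs
  imports "HOL-Analysis.Analysis"
begin

subsection \<open>Smooth functions\<close>

definition smooth_real :: "(real \<Rightarrow> real) \<Rightarrow> bool" where
  "smooth_real h \<longleftrightarrow> (\<forall>k x. (deriv ^^ k) h differentiable at x)"

text \<open>
  Points of \<open>n\<close>-dimensional Euclidean space are functions \<open>nat \<Rightarrow> real\<close> vanishing
  from index \<open>n\<close> on, as in \<^const>\<open>Euclidean_space\<close>. In this way the dimension can be quantified
  over inside a formula.
\<close>

definition pdiff :: "nat \<Rightarrow> ((nat \<Rightarrow> real) \<Rightarrow> real) \<Rightarrow> (nat \<Rightarrow> real) \<Rightarrow> real" where
  "pdiff i F x = deriv (\<lambda>t. F (x(i := t))) (x i)"

primrec Ck_on :: "nat \<Rightarrow> nat \<Rightarrow> (nat \<Rightarrow> real) set \<Rightarrow> ((nat \<Rightarrow> real) \<Rightarrow> real) \<Rightarrow> bool" where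
  "Ck_on n 0 V F \<longleftrightarrow> continuous_map (subtopology (Euclidean_space n) V) euclideanreal F"
| "Ck_on n (Suc k) V F \<longleftrightarrow>
     continuous_map (subtopology (Euclidean_space n) V) euclideanreal F \<and>
     (\<forall>i<n. (\<forall>x\<in>V. (\<lambda>t. F (x(i := t))) differentiable at (x i)) \<and> Ck_on n k V (pdiff i F))"

text \<open>Meant for open subsets \<open>V\<close> of \<open>Euclidean_space n\<close>.\<close>

definition smooth_on :: "nat \<Rightarrow> (nat \<Rightarrow> real) set \<Rightarrow> ((nat \<Rightarrow> real) \<Rightarrow> real) \<Rightarrow> bool" where
  "smooth_on n V F \<longleftrightarrow> (\<forall>k. Ck_on n k V F)"

subsection \<open>Smooth manifolds\<close>

text \<open>A chart is given by its domain and its coordinate map.\<close>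

type_synonym 'a chart = "'a set \<times> ('a \<Rightarrow> nat \<Rightarrow> real)"

abbreviation dom_of :: "'a chart \<Rightarrow> 'a set" where "dom_of c \<equiv> fst c"
abbreviation coord :: "'a chart \<Rightarrow> 'a \<Rightarrow> nat \<Rightarrow> real" where "coord c \<equiv> snd c"

definition chart_inv :: "'a chart \<Rightarrow> (nat \<Rightarrow> real) \<Rightarrow> 'a" where
  "chart_inv c = inv_into (dom_of c) (coord c)"

definition is_chart :: "nat \<Rightarrow> 'a topology \<Rightarrow> 'a chart \<Rightarrow> bool" where
  "is_chart n X c \<longleftrightarrow>
     openin X (dom_of c) \<and>
     openin (Euclidean_space n) (coord c ` dom_of c) \<and>
     homeomorphic_map (subtopology X (dom_of c))
       (subtopology (Euclidean_space n) (coord c ` dom_of c)) (coord c)"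

definition smoothly_compatible :: "nat \<Rightarrow> 'a chart \<Rightarrow> 'a chart \<Rightarrow> bool" where
  "smoothly_compatible n c d \<longleftrightarrow>
     (\<forall>k<n. smooth_on n (coord c ` (dom_of c \<inter> dom_of d)) (\<lambda>x. coord d (chart_inv c x) k))"

text \<open>The atlas need not be maximal.\<close>

definition smooth_manifold :: "nat \<Rightarrow> 'a topology \<Rightarrow> 'a chart set \<Rightarrow> bool" where
  "smooth_manifold n X A \<longleftrightarrow>
     Hausdorff_space X \<and> second_countable X \<and>
     (\<forall>c\<in>A. is_chart n X c) \<and>
     topspace X = (\<Union>c\<in>A. dom_of c) \<and>
     (\<forall>c\<in>A. \<forall>d\<in>A. smoothly_compatible n c d)"

definition smooth_in_chart :: "nat \<Rightarrow> 'a chart \<Rightarrow> ('a \<Rightarrow> real) \<Rightarrow> bool" where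
  "smooth_in_chart n c f \<longleftrightarrow> smooth_on n (coord c ` dom_of c) (f \<circ> chart_inv c)"

definition smooth_function :: "nat \<Rightarrow> 'a chart set \<Rightarrow> ('a \<Rightarrow> real) \<Rightarrow> bool" where
  "smooth_function n A f \<longleftrightarrow> (\<forall>c\<in>A. smooth_in_chart n c f)"

text \<open>\<open>chart_pdiff c i f\<close> is the partial derivative of \<open>f\<close> along the \<open>i\<close>-th coordinate of \<open>c\<close>,
  that is, the \<open>i\<close>-th component of \<open>df\<close> in the chart \<open>c\<close>.\<close>

definition chart_pdiff :: "'a chart \<Rightarrow> nat \<Rightarrow> ('a \<Rightarrow> real) \<Rightarrow> 'a \<Rightarrow> real" where
  "chart_pdiff c i f p = pdiff i (f \<circ> chart_inv c) (coord c p)"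

subsection \<open>Riemannian metrics\<close>

text \<open>
  Tensor fields are given by their components in every chart of the atlas: \<open>g c i j p\<close> is the
  value of the metric at \<open>p\<close> on the \<open>i\<close>-th and \<open>j\<close>-th coordinate vectors of \<open>c\<close>, for \<open>i, j < n\<close>.
\<close>

definition riemannian_metric ::
  "nat \<Rightarrow> 'a chart set \<Rightarrow> ('a chart \<Rightarrow> nat \<Rightarrow> nat \<Rightarrow> 'a \<Rightarrow> real) \<Rightarrow> bool" where
  "riemannian_metric n A g \<longleftrightarrow>
     (\<forall>c\<in>A. \<forall>i<n. \<forall>j<n. smooth_in_chart n c (g c i j)) \<and>
     (\<forall>c\<in>A. \<forall>p\<in>dom_of c. \<forall>i<n. \<forall>j<n. g c i j p = g c j i p) \<and>
     (\<forall>c\<in>A. \<forall>p\<in>dom_of c. \<forall>v. (\<exists>i<n. v i \<noteq> 0) \<longrightarrow>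
        (\<Sum>i<n. \<Sum>j<n. g c i j p * v i * v j) > 0) \<and>
     (\<forall>c\<in>A. \<forall>d\<in>A. \<forall>p\<in>dom_of c \<inter> dom_of d. \<forall>i<n. \<forall>j<n.
        g c i j p =
          (\<Sum>k<n. \<Sum>l<n. chart_pdiff c i (\<lambda>q. coord d q k) p *
             chart_pdiff c j (\<lambda>q. coord d q l) p * g d k l p))"

text \<open>
  The definitions below use the components \<open>G i j\<close> of the metric in one chart \<open>c\<close>. Those that
  yield components are zero at indices from \<open>n\<close> on, so that the definite descriptions pick out
  a unique object.
\<close>

text \<open>\<open>grad n c G f p i\<close>: the vector \<open>v\<close> with \<open>g(v, \<cdot>) = df\<close>.\<close>

definition grad ::
  "nat \<Rightarrow> 'a chart \<Rightarrow> (nat \<Rightarrow> nat \<Rightarrow> 'a \<Rightarrow> real) \<Rightarrow> ('a \<Rightarrow> real) \<Rightarrow> 'a \<Rightarrow> nat \<Rightarrow> real" where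
  "grad n c G f p = (THE v. (\<forall>i\<ge>n. v i = 0) \<and>
     (\<forall>i<n. (\<Sum>j<n. G i j p * v j) = chart_pdiff c i f p))"

definition grad_norm_sq ::
  "nat \<Rightarrow> 'a chart \<Rightarrow> (nat \<Rightarrow> nat \<Rightarrow> 'a \<Rightarrow> real) \<Rightarrow> ('a \<Rightarrow> real) \<Rightarrow> 'a \<Rightarrow> real" where
  "grad_norm_sq n c G f p = (\<Sum>i<n. \<Sum>j<n. G i j p * grad n c G f p i * grad n c G f p j)"

text \<open>
  \<open>levi_civita n c G p l i j\<close> is the \<open>l\<close>-th component of the covariant derivative of the \<open>j\<close>-th
  coordinate vector field along the \<open>i\<close>-th one. The Levi-Civita connection is the unique
  torsion-free (first condition) and metric (second condition) connection; both conditions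
  determine its coefficients pointwise.
\<close>

definition levi_civita ::
  "nat \<Rightarrow> 'a chart \<Rightarrow> (nat \<Rightarrow> nat \<Rightarrow> 'a \<Rightarrow> real) \<Rightarrow> 'a \<Rightarrow> nat \<Rightarrow> nat \<Rightarrow> nat \<Rightarrow> real" where
  "levi_civita n c G p = (THE \<Gamma>.
     (\<forall>l<n. \<forall>i<n. \<forall>j<n. \<Gamma> l i j = \<Gamma> l j i) \<and>
     (\<forall>k<n. \<forall>i<n. \<forall>j<n. chart_pdiff c k (G i j) p =
        (\<Sum>l<n. \<Gamma> l k i * G l j p) + (\<Sum>l<n. \<Gamma> l k j * G i l p)) \<and>
     (\<forall>l i j. n \<le> l \<or> n \<le> i \<or> n \<le> j \<longrightarrow> \<Gamma> l i j = 0))"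

subsection \<open>Differential 2-forms\<close>

definition wedge ::
  "(nat \<Rightarrow> 'a \<Rightarrow> real) \<Rightarrow> (nat \<Rightarrow> 'a \<Rightarrow> real) \<Rightarrow> nat \<Rightarrow> nat \<Rightarrow> 'a \<Rightarrow> real" where
  "wedge \<alpha> \<beta> j k p = \<alpha> j p * \<beta> k p - \<beta> j p * \<alpha> k p"

text \<open>The components in the chart \<open>c\<close> of the 2-form \<open>h(f) df \<and> d|\<nabla>f|\<^sup>2\<close>.\<close>

definition omega_form ::
  "(real \<Rightarrow> real) \<Rightarrow> nat \<Rightarrow> 'a chart \<Rightarrow> (nat \<Rightarrow> nat \<Rightarrow> 'a \<Rightarrow> real) \<Rightarrow> ('a \<Rightarrow> real)
     \<Rightarrow> nat \<Rightarrow> nat \<Rightarrow> 'a \<Rightarrow> real" where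
  "omega_form h n c G f j k p =
     h (f p) * wedge (\<lambda>i. chart_pdiff c i f) (\<lambda>i. chart_pdiff c i (grad_norm_sq n c G f)) j k p"

text \<open>The component \<open>\<nabla>\<^sub>i\<omega>\<^sub>j\<^sub>k\<close> in the coordinate frame of \<open>c\<close>.\<close>

definition cov_deriv ::
  "nat \<Rightarrow> 'a chart \<Rightarrow> (nat \<Rightarrow> nat \<Rightarrow> 'a \<Rightarrow> real) \<Rightarrow> (nat \<Rightarrow> nat \<Rightarrow> 'a \<Rightarrow> real)
     \<Rightarrow> 'a \<Rightarrow> nat \<Rightarrow> nat \<Rightarrow> nat \<Rightarrow> real" where
  "cov_deriv n c G \<omega> p i j k = chart_pdiff c i (\<omega> j k) p
     - (\<Sum>l<n. levi_civita n c G p l i j * \<omega> l k p)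
     - (\<Sum>l<n. levi_civita n c G p l i k * \<omega> j l p)"

text \<open>\<open>E a i\<close> is the \<open>i\<close>-th coordinate component of the \<open>a\<close>-th vector of the frame at \<open>p\<close>.\<close>

definition orthonormal_frame ::
  "nat \<Rightarrow> (nat \<Rightarrow> nat \<Rightarrow> 'a \<Rightarrow> real) \<Rightarrow> 'a \<Rightarrow> (nat \<Rightarrow> nat \<Rightarrow> real) \<Rightarrow> bool" where
  "orthonormal_frame n G p E \<longleftrightarrow>
     (\<forall>a<n. \<forall>b<n. (\<Sum>i<n. \<Sum>j<n. G i j p * E a i * E b j) = (if a = b then 1 else 0))"

text \<open>The component \<open>\<nabla>\<^sub>a\<omega>\<^sub>b\<^sub>d\<close> in the frame \<open>E\<close>.\<close>

definition frame_cov_deriv ::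
  "nat \<Rightarrow> 'a chart \<Rightarrow> (nat \<Rightarrow> nat \<Rightarrow> 'a \<Rightarrow> real) \<Rightarrow> (nat \<Rightarrow> nat \<Rightarrow> 'a \<Rightarrow> real)
     \<Rightarrow> 'a \<Rightarrow> (nat \<Rightarrow> nat \<Rightarrow> real) \<Rightarrow> nat \<Rightarrow> nat \<Rightarrow> nat \<Rightarrow> real" where
  "frame_cov_deriv n c G \<omega> p E a b d =
     (\<Sum>i<n. \<Sum>j<n. \<Sum>k<n. E a i * E b j * E d k * cov_deriv n c G \<omega> p i j k)"

text \<open>Neither of the two norms depends on the orthonormal frame \<open>E\<close>.\<close>

definition cov_deriv_norm_sq ::
  "nat \<Rightarrow> 'a chart \<Rightarrow> (nat \<Rightarrow> nat \<Rightarrow> 'a \<Rightarrow> real) \<Rightarrow> (nat \<Rightarrow> nat \<Rightarrow> 'a \<Rightarrow> real)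
     \<Rightarrow> 'a \<Rightarrow> (nat \<Rightarrow> nat \<Rightarrow> real) \<Rightarrow> real" where
  "cov_deriv_norm_sq n c G \<omega> p E =
     (\<Sum>k<n. \<Sum>j<k. \<Sum>i<n. (frame_cov_deriv n c G \<omega> p E i j k)\<^sup>2)"

definition codiff ::
  "nat \<Rightarrow> 'a chart \<Rightarrow> (nat \<Rightarrow> nat \<Rightarrow> 'a \<Rightarrow> real) \<Rightarrow> (nat \<Rightarrow> nat \<Rightarrow> 'a \<Rightarrow> real)
     \<Rightarrow> 'a \<Rightarrow> (nat \<Rightarrow> nat \<Rightarrow> real) \<Rightarrow> nat \<Rightarrow> real" where
  "codiff n c G \<omega> p E k = - (\<Sum>i<n. frame_cov_deriv n c G \<omega> p E i i k)"

definition codiff_norm_sq ::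
  "nat \<Rightarrow> 'a chart \<Rightarrow> (nat \<Rightarrow> nat \<Rightarrow> 'a \<Rightarrow> real) \<Rightarrow> (nat \<Rightarrow> nat \<Rightarrow> 'a \<Rightarrow> real)
     \<Rightarrow> 'a \<Rightarrow> (nat \<Rightarrow> nat \<Rightarrow> real) \<Rightarrow> real" where
  "codiff_norm_sq n c G \<omega> p E = (\<Sum>k<n. (codiff n c G \<omega> p E k)\<^sup>2)"

text \<open>
  A second countable Hausdorff manifold has at most continuum many points, so asking for a
  manifold whose points have type \<open>nat \<Rightarrow> real\<close> is no restriction.
\<close>

end

theory Submission
  imports Defs
begin

text \<open>
  In dimension three, a \<open>2\<close>-form is the Hodge dual of a \<open>1\<close>-form \<open>\<alpha>\<close>, and the inequality asks that
  \<open>\<nabla>\<alpha>\<close> be shorter than the curl of \<open>\<alpha>\<close>. Rotation fields such as \<open>x dy - y dx\<close> have this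
  property, because \<open>|curl \<alpha>|\<^sup>2 = 2 |\<nabla>\<alpha>|\<^sup>2\<close> when \<open>\<nabla>\<alpha>\<close> is antisymmetric. The same happens
  in a warped product \<open>h + W\<^sup>2 dz\<^sup>2\<close> over a surface with metric \<open>h\<close>: for a form \<open>\<omega> = \<phi> dA\<close>, with
  \<open>dA\<close> the area form of \<open>h\<close> and \<open>\<phi>\<close> a function on the surface, one finds
  \<open>|\<delta>\<omega>|\<^sup>2 - |\<nabla>\<omega>|\<^sup>2 = 2 \<phi> \<langle>\<nabla>\<phi>, \<nabla>W\<rangle> / W\<close>. It is positive if \<open>W\<close> grows in a direction in
  which \<open>\<phi>\<^sup>2\<close> grows.

  If \<open>f\<close> is the coordinate \<open>x\<close>, then \<open>|\<nabla>f|\<^sup>2\<close> is the coefficient \<open>g\<^sup>x\<^sup>x\<close> of the inverse metric, so that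
  the metric can be chosen to prescribe \<open>\<omega>\<close>, while \<open>\<lambda>(f) = \<lambda>(x)\<close> is constant along \<open>y\<close>, the
  direction in which \<open>\<phi>\<close> and \<open>W\<close> are made to grow. This leads to
  \<open>g = e\<^sup>-\<^sup>y dx\<^sup>2 + dy\<^sup>2 + e\<^sup>y dz\<^sup>2\<close> on the open set of all \<open>(x, y, z)\<close> with \<open>\<lambda>(x) \<noteq> 0\<close>. Here
  \<open>\<omega> = \<lambda>(x) e\<^sup>y dx \<and> dy\<close>, and with \<open>D = \<lambda>'(x) e\<^sup>2\<^sup>y\<close> and \<open>q = \<lambda>(x) e\<^sup>3\<^sup>y\<^sup>/\<^sup>2\<close>
  the two sides are \<open>|\<nabla>\<omega>|\<^sup>2 = D\<^sup>2 + 5/2 q\<^sup>2\<close> and \<open>|\<delta>\<omega>|\<^sup>2 = D\<^sup>2 + 4 q\<^sup>2\<close>.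

  The manifold has a single chart, the identity, and the metric is diagonal in it. This makes the
  gradient and the Levi-Civita connection explicit (\<open>grad_norm_sq_diagonal\<close>,
  \<open>levi_civita_diagonal\<close>), from which \<open>cov_deriv_warped\<close> computes \<open>\<nabla>\<omega>\<close>. The norms are taken in
  an arbitrary orthonormal frame. They are brought back to coordinates by a Parseval identity, which
  rests on the completeness relation \<open>\<Sum>\<^sub>a E\<^sub>a\<^sup>i E\<^sub>a\<^sup>j = g\<^sup>i\<^sup>j\<close> (\<open>orthonormal_frame_complete\<close>).
\<close>

section \<open>Calculus on open subsets of Euclidean space\<close>

text \<open>Makes \<^const>\<open>pdiff\<close> local on open sets. This is needed because the inverse of a chart is
  unspecified outside the image of the chart.\<close>

lemma eventually_fun_upd_mem:
  assumes "openin (Euclidean_space n) U" "x \<in> U" "i < n"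
  shows "\<forall>\<^sub>F t in nhds (x i). x(i := t) \<in> U"
proof -
  obtain T where T: "open T" "U = T \<inter> {x. \<forall>i\<ge>n. x i = 0}"
    using assms(1) by (auto simp: Euclidean_space_def openin_subtopology euclidean_product_topology)
  have "continuous_on UNIV (\<lambda>t. x(i := t) :: nat \<Rightarrow> real)"
  proof (rule continuous_on_coordinatewise_then_product)
    show "continuous_on UNIV (\<lambda>t. (x(i := t)) j)" for j
      by (cases "j = i") auto
  qed
  then have "open ((\<lambda>t. x(i := t)) -` T)"
    using T(1) by (simp add: open_vimage)
  moreover have "x i \<in> (\<lambda>t. x(i := t)) -` T"
    using assms(2) T(2) by auto
  ultimately have "\<forall>\<^sub>F t in nhds (x i). t \<in> (\<lambda>t. x(i := t)) -` T"
    by (rule eventually_nhds_in_open)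
  then show ?thesis
    by (rule eventually_mono) (use T(2) assms(2,3) in auto)
qed

lemma pdiff_cong:
  assumes "openin (Euclidean_space n) U" "x \<in> U" "i < n" "\<And>y. y \<in> U \<Longrightarrow> F y = G y"
  shows "pdiff i F x = pdiff i G x"
  unfolding pdiff_def
  by (rule deriv_cong_ev) (use eventually_fun_upd_mem[OF assms(1-3)] assms(4) in \<open>auto elim: eventually_mono\<close>)

lemma Ck_on_cong:
  assumes "openin (Euclidean_space n) U" "\<And>y. y \<in> U \<Longrightarrow> F y = G y" "Ck_on n k U F"
  shows "Ck_on n k U G"
  using assms(2,3)
proof (induction k arbitrary: F G)
  case 0
  then show ?case by (auto elim!: continuous_map_eq)
next
  case (Suc k)
  have "continuous_map (subtopology (Euclidean_space n) U) euclideanreal G"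
    using Suc.prems by (auto elim!: continuous_map_eq)
  moreover have "(\<lambda>t. G (x(i := t))) differentiable at (x i)" if "i < n" "x \<in> U" for i x
  proof -
    have "(\<lambda>t. F (x(i := t))) differentiable at (x i)"
      using Suc.prems(2) that by simp
    moreover have "\<forall>\<^sub>F t in nhds (x i). F (x(i := t)) = G (x(i := t))"
      using eventually_fun_upd_mem[OF assms(1) that(2,1)] by (rule eventually_mono) (rule Suc.prems(1))
    ultimately show ?thesis
      unfolding real_differentiable_def by (metis DERIV_cong_ev)
  qed
  moreover have "Ck_on n k U (pdiff i G)" if "i < n" for i
  proof (rule Suc.IH)
    show "pdiff i F y = pdiff i G y" if "y \<in> U" for y
      using pdiff_cong[OF assms(1) that \<open>i < n\<close>] Suc.prems(1) by blast
    show "Ck_on n k U (pdiff i F)" using Suc.prems(2) that by simp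
  qed
  ultimately show ?case by simp
qed

lemma continuous_map_coordinate:
  "continuous_map (subtopology (Euclidean_space n) V) euclideanreal (\<lambda>x. x j)"
  unfolding Euclidean_space_def
  by (intro continuous_map_from_subtopology continuous_map_product_projection) simp

lemma continuous_map_exp_coordinate:
  "continuous_map (subtopology (Euclidean_space n) V) euclideanreal (\<lambda>x. a * exp (c * x j))"
proof -
  have "continuous_map euclideanreal euclideanreal (\<lambda>t. a * exp (c * t))"
    by (auto intro!: continuous_intros)
  from continuous_map_compose[OF continuous_map_coordinate this] show ?thesis
    by (simp add: o_def)
qed

lemma pdiff_coordinate: "pdiff i (\<lambda>x. x j) x = (if i = j then 1 else 0)"
  by (simp add: pdiff_def)

lemma pdiff_exp_coordinate:
  "pdiff i (\<lambda>x. a * exp (c * x j)) x = (if i = j then a * c else 0) * exp (c * x j)"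
proof (cases "i = j")
  case True
  have "((\<lambda>t. a * exp (c * t)) has_field_derivative a * c * exp (c * x j)) (at (x j))"
    by (auto intro!: derivative_eq_intros)
  then show ?thesis using True by (simp add: pdiff_def DERIV_imp_deriv)
qed (simp add: pdiff_def)

text \<open>The factor \<open>a\<close> closes this family under partial derivatives, and it also covers the constants
  and the vanishing off-diagonal components of a metric.\<close>

lemma smooth_on_exp_coordinate: "smooth_on n V (\<lambda>x. a * exp (c * x j))"
proof -
  have "Ck_on n k V (\<lambda>x. a * exp (c * x j))" for k a
  proof (induction k arbitrary: a)
    case 0
    show ?case by (simp add: continuous_map_exp_coordinate)
  next
    case (Suc k)
    have "(\<lambda>t. a * exp (c * (x(i := t)) j)) differentiable at (x i)" for x i
      unfolding real_differentiable_def
      by (cases "i = j") (auto intro!: derivative_eq_intros exI)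
    then show ?case
      using Suc.IH by (simp add: pdiff_exp_coordinate[abs_def] continuous_map_exp_coordinate)
  qed
  then show ?thesis by (simp add: smooth_on_def)
qed

lemma smooth_on_const: "smooth_on n V (\<lambda>x. a)"
  using smooth_on_exp_coordinate[of n V a 0] by simp

lemma smooth_on_coordinate: "smooth_on n V (\<lambda>x. x j)"
proof -
  have "Ck_on n k V (\<lambda>x. x j)" for k
  proof (cases k)
    case 0
    then show ?thesis by (simp add: continuous_map_coordinate)
  next
    case (Suc m)
    have "(\<lambda>t. (x(i := t)) j) differentiable at (x i)" for x :: "nat \<Rightarrow> real" and i
      by (cases "i = j") auto
    then show ?thesis
      using Suc smooth_on_const
      by (auto simp: pdiff_coordinate[abs_def] continuous_map_coordinate smooth_on_def)
  qed
  then show ?thesis by (simp add: smooth_on_def)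
qed

section \<open>Open subsets as manifolds\<close>

lemma chart_inv_id: "x \<in> U \<Longrightarrow> chart_inv (U, \<lambda>x. x) x = x"
  using inv_into_f_f[of "\<lambda>x. x" U x] by (simp add: chart_inv_def)

lemma smooth_in_chart_id:
  assumes "openin (Euclidean_space n) U" "smooth_on n U F"
  shows "smooth_in_chart n (U, \<lambda>x. x) F"
  unfolding smooth_in_chart_def smooth_on_def
proof
  show "Ck_on n k (coord (U, \<lambda>x. x) ` dom_of (U, \<lambda>x. x)) (F \<circ> chart_inv (U, \<lambda>x. x))" for k
    using Ck_on_cong[OF assms(1), of F "F \<circ> chart_inv (U, \<lambda>x. x)" k] assms(2)
    by (simp add: smooth_on_def chart_inv_id)
qed

lemma chart_pdiff_id:
  assumes "openin (Euclidean_space n) U" "p \<in> U" "i < n" "\<And>y. y \<in> U \<Longrightarrow> F y = G y"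
  shows "chart_pdiff (U, \<lambda>x. x) i F p = pdiff i G p"
  unfolding chart_pdiff_def snd_conv
  by (rule pdiff_cong[OF assms(1-3)]) (simp add: chart_inv_id assms(4))

lemma second_countable_Euclidean_space: "second_countable (Euclidean_space n)"
proof -
  obtain B :: "(nat \<Rightarrow> real) set set" where "countable B" "topological_basis B"
    using ex_countable_basis by auto
  then have "second_countable (euclidean :: (nat \<Rightarrow> real) topology)"
    unfolding second_countable_def open_openin[symmetric]
    by (metis topological_basisE topological_basis_open)
  then show ?thesis
    by (simp add: Euclidean_space_def euclidean_product_topology second_countable_subtopology)
qed

lemma smooth_manifold_open_subset:
  assumes "openin (Euclidean_space n) U"
  shows "smooth_manifold n (subtopology (Euclidean_space n) U) {(U, \<lambda>x. x)}"
proof -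
  have "U \<subseteq> topspace (Euclidean_space n)"
    using assms by (rule openin_subset)
  moreover have "smooth_on n U (\<lambda>x. chart_inv (U, \<lambda>x. x) x k)" for k
    unfolding smooth_on_def
    using Ck_on_cong[OF assms, of "\<lambda>x. x k" "\<lambda>x. chart_inv (U, \<lambda>x. x) x k"] smooth_on_coordinate
    by (simp add: smooth_on_def chart_inv_id)
  moreover have "homeomorphic_map X X (\<lambda>x. x)" for X :: "(nat \<Rightarrow> real) topology"
    unfolding id_def[symmetric] by simp
  ultimately show ?thesis
    using assms
    by (auto simp: smooth_manifold_def is_chart_def smoothly_compatible_def subtopology_subtopology
      Hausdorff_space_subtopology Hausdorff_Euclidean_space second_countable_subtopology
      second_countable_Euclidean_space openin_open_subtopology)
qed

section \<open>Diagonal metrics\<close>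

lemma grad_diagonal:
  assumes G: "\<And>i j. i < n \<Longrightarrow> j < n \<Longrightarrow> G i j p = (if i = j then w i else 0)"
    and w: "\<And>i. i < n \<Longrightarrow> w i \<noteq> 0"
  shows "grad n c G f p = (\<lambda>i. if i < n then chart_pdiff c i f p / w i else 0)"
proof -
  have *: "(\<Sum>j<n. G i j p * v j) = w i * v i" if "i < n" for i v
  proof -
    have "(\<Sum>j<n. G i j p * v j) = (\<Sum>j<n. if i = j then w i * v i else 0)"
      by (rule sum.cong) (auto simp: G that)
    then show ?thesis using that by simp
  qed
  show ?thesis
    unfolding grad_def
  proof (rule the_equality)
    show "v = (\<lambda>i. if i < n then chart_pdiff c i f p / w i else 0)"
      if "(\<forall>i\<ge>n. v i = 0) \<and> (\<forall>i<n. (\<Sum>j<n. G i j p * v j) = chart_pdiff c i f p)" for v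
    proof
      show "v i = (if i < n then chart_pdiff c i f p / w i else 0)" for i
        using that w[of i] *[of i v] by (auto simp: field_simps)
    qed
  next
    show "(\<forall>i\<ge>n. (if i < n then chart_pdiff c i f p / w i else 0) = 0) \<and>
      (\<forall>i<n. (\<Sum>j<n. G i j p * (if j < n then chart_pdiff c j f p / w j else 0)) = chart_pdiff c i f p)"
      using w by (auto simp only: * if_True) auto
  qed
qed

lemma grad_norm_sq_diagonal:
  assumes G: "\<And>i j. i < n \<Longrightarrow> j < n \<Longrightarrow> G i j p = (if i = j then w i else 0)"
    and w: "\<And>i. i < n \<Longrightarrow> w i \<noteq> 0"
  shows "grad_norm_sq n c G f p = (\<Sum>i<n. (chart_pdiff c i f p)\<^sup>2 / w i)"
proof -
  have "(\<Sum>j<n. G i j p * grad n c G f p i * grad n c G f p j) = (chart_pdiff c i f p)\<^sup>2 / w i"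
    if "i < n" for i
  proof -
    have "(\<Sum>j<n. G i j p * grad n c G f p i * grad n c G f p j)
      = (\<Sum>j<n. if i = j then (chart_pdiff c i f p)\<^sup>2 / w i else 0)"
      using that w[of i] by (intro sum.cong refl) (auto simp: G grad_diagonal[of n G p w, OF G w] power2_eq_square)
    then show ?thesis using that by simp
  qed
  then show ?thesis by (simp add: grad_norm_sq_def)
qed

text \<open>Lowering the upper index turns the two conditions on the connection into a torsion-free one,
  symmetry in the last two indices, and a metric one, in which each derivative of \<open>g\<close> is a sum of two
  lowered coefficients. The alternating sum of three cyclic instances of the latter
  isolates one coefficient, which is Koszul's formula.\<close>

lemma levi_civita_diagonal:
  assumes G: "\<And>i j. i < n \<Longrightarrow> j < n \<Longrightarrow> G i j p = (if i = j then w i else 0)"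
    and w: "\<And>i. i < n \<Longrightarrow> w i \<noteq> 0"
    and dG: "\<And>k i j. k < n \<Longrightarrow> i < n \<Longrightarrow> j < n \<Longrightarrow>
      chart_pdiff c k (G i j) p = (if i = j then dw k i else 0)"
  shows "levi_civita n c G p = (\<lambda>l i j. if l < n \<and> i < n \<and> j < n then
     ((if l = j then dw i l else 0) + (if l = i then dw j l else 0) - (if i = j then dw l i else 0))
       / (2 * w l) else 0)"
proof -
  have sum1: "(\<Sum>l<n. \<Gamma> l k i * G l j p) = \<Gamma> j k i * w j" if "j < n" for \<Gamma> :: "nat \<Rightarrow> nat \<Rightarrow> nat \<Rightarrow> real" and k i j
  proof -
    have "(\<Sum>l<n. \<Gamma> l k i * G l j p) = (\<Sum>l<n. if j = l then \<Gamma> j k i * w j else 0)"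
      by (rule sum.cong) (auto simp: G that)
    then show ?thesis using that by simp
  qed
  have sum2: "(\<Sum>l<n. \<Gamma> l k j * G i l p) = \<Gamma> i k j * w i" if "i < n" for \<Gamma> :: "nat \<Rightarrow> nat \<Rightarrow> nat \<Rightarrow> real" and k i j
  proof -
    have "(\<Sum>l<n. \<Gamma> l k j * G i l p) = (\<Sum>l<n. if i = l then \<Gamma> i k j * w i else 0)"
      by (rule sum.cong) (auto simp: G that)
    then show ?thesis using that by simp
  qed
  define K where "K l i j = (if l = j then dw i l else 0) + (if l = i then dw j l else 0)
    - (if i = j then dw l i else 0)" for l i j
  define \<Gamma>\<^sub>0 where "\<Gamma>\<^sub>0 l i j = (if l < n \<and> i < n \<and> j < n then K l i j / (2 * w l) else 0)" for l i j
  have lowered: "\<Gamma>\<^sub>0 l i j * w l = K l i j / 2" if "l < n" "i < n" "j < n" for l i j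
    using that w[of l] by (simp add: \<Gamma>\<^sub>0_def)
  have "levi_civita n c G p = \<Gamma>\<^sub>0"
    unfolding levi_civita_def
  proof (rule the_equality)
    show "(\<forall>l<n. \<forall>i<n. \<forall>j<n. \<Gamma>\<^sub>0 l i j = \<Gamma>\<^sub>0 l j i) \<and>
     (\<forall>k<n. \<forall>i<n. \<forall>j<n. chart_pdiff c k (G i j) p =
        (\<Sum>l<n. \<Gamma>\<^sub>0 l k i * G l j p) + (\<Sum>l<n. \<Gamma>\<^sub>0 l k j * G i l p)) \<and>
     (\<forall>l i j. n \<le> l \<or> n \<le> i \<or> n \<le> j \<longrightarrow> \<Gamma>\<^sub>0 l i j = 0)"
    proof (intro conjI allI impI)
      show "\<Gamma>\<^sub>0 l i j = \<Gamma>\<^sub>0 l j i" for l i j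
        by (simp add: \<Gamma>\<^sub>0_def K_def)
      show "chart_pdiff c k (G i j) p =
        (\<Sum>l<n. \<Gamma>\<^sub>0 l k i * G l j p) + (\<Sum>l<n. \<Gamma>\<^sub>0 l k j * G i l p)"
        if "k < n" "i < n" "j < n" for k i j
        using that by (simp add: sum1 sum2 lowered dG) (simp add: K_def)
      show "\<Gamma>\<^sub>0 l i j = 0" if "n \<le> l \<or> n \<le> i \<or> n \<le> j" for l i j
        using that by (auto simp: \<Gamma>\<^sub>0_def)
    qed
  next
    fix \<Gamma> assume *: "(\<forall>l<n. \<forall>i<n. \<forall>j<n. \<Gamma> l i j = \<Gamma> l j i) \<and>
     (\<forall>k<n. \<forall>i<n. \<forall>j<n. chart_pdiff c k (G i j) p =
        (\<Sum>l<n. \<Gamma> l k i * G l j p) + (\<Sum>l<n. \<Gamma> l k j * G i l p)) \<and>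
     (\<forall>l i j. n \<le> l \<or> n \<le> i \<or> n \<le> j \<longrightarrow> \<Gamma> l i j = 0)"
    have metric: "(if i = j then dw k i else 0) = \<Gamma> j k i * w j + \<Gamma> i k j * w i"
      if "k < n" "i < n" "j < n" for i j k
    proof -
      have "chart_pdiff c k (G i j) p = (\<Sum>l<n. \<Gamma> l k i * G l j p) + (\<Sum>l<n. \<Gamma> l k j * G i l p)"
        using * that by blast
      then show ?thesis
        by (simp only: sum1[OF that(3)] sum2[OF that(2)] dG[OF that])
    qed
    have symmetric: "\<Gamma> l i j * w l = \<Gamma> l j i * w l" if "l < n" "i < n" "j < n" for l i j
      using * that by (metis (no_types))
    show "\<Gamma> = \<Gamma>\<^sub>0"
    proof (intro ext)
      fix l i j
      show "\<Gamma> l i j = \<Gamma>\<^sub>0 l i j"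
      proof (cases "l < n \<and> i < n \<and> j < n")
        case True
        then have "2 * (\<Gamma> l i j * w l) = K l i j"
          unfolding K_def
          using metric[of i l j] metric[of j l i] metric[of l i j]
            symmetric[of l i j] symmetric[of i l j] symmetric[of j l i]
          by linarith
        then show ?thesis
          using True w[of l] by (simp add: \<Gamma>\<^sub>0_def eq_divide_eq)
      next
        case False
        then show ?thesis
          using * by (auto simp: \<Gamma>\<^sub>0_def not_less)
      qed
    qed
  qed
  then show ?thesis
    unfolding \<Gamma>\<^sub>0_def[abs_def] K_def .
qed

section \<open>Norms and orthonormal frames\<close>

text \<open>With \<open>M\<close> the matrix of the frame and \<open>N = G M\<^sup>T\<close>, orthonormality says \<open>M N = 1\<close>. Then also
  \<open>N M = 1\<close>, so that \<open>M\<^sup>T M\<close> is the inverse of \<open>G\<close>.\<close>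

lemma orthonormal_frame_complete:
  assumes E: "orthonormal_frame 3 G p E"
    and G: "\<And>i j. i < 3 \<Longrightarrow> j < 3 \<Longrightarrow> G i j p = (if i = j then w i else 0)"
    and "i < 3" "j < 3"
  shows "(\<Sum>a<3. E a i * E a j) = (if i = j then 1 / w i else 0)"
proof -
  \<comment> \<open>In the numeral type, the literal \<open>3\<close> denotes the same element as \<open>0\<close>; it gets the index \<open>2\<close>.\<close>
  define e :: "3 \<Rightarrow> nat" where "e = (\<lambda>a. if a = 1 then 0 else if a = 2 then 1 else 2)"
  have e3: "(\<Sum>a<3. h a) = (\<Sum>a\<in>UNIV. h (e a))" for h :: "nat \<Rightarrow> real"
    by (simp add: sum_3 e_def eval_nat_numeral)
  have lt: "e a < 3" for a by (simp add: e_def)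
  have inj: "e a = e b \<longleftrightarrow> a = b" for a b
    using exhaust_3[of a] exhaust_3[of b] by (auto simp: e_def)
  define M N :: "real ^ 3 ^ 3"
    where "M = (\<chi> a i. E (e a) (e i))" and "N = (\<chi> i b. w (e i) * E (e b) (e i))"
  have "(\<Sum>i<3. E a i * (w i * E b i)) = (if a = b then 1 else 0)" if "a < 3" "b < 3" for a b
  proof -
    have "(\<Sum>j<3. G i j p * E a i * E b j) = E a i * (w i * E b i)" if "i < 3" for i
    proof -
      have "(\<Sum>j<3. G i j p * E a i * E b j) = (\<Sum>j<3. if i = j then E a i * (w i * E b i) else 0)"
        by (rule sum.cong) (auto simp: G that)
      then show ?thesis using that by simp
    qed
    then have "(\<Sum>i<3. E a i * (w i * E b i)) = (\<Sum>i<3. \<Sum>j<3. G i j p * E a i * E b j)"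
      by (intro sum.cong) simp_all
    then show ?thesis
      using E that by (simp add: orthonormal_frame_def)
  qed
  then have "M ** N = mat 1"
    by (simp add: M_def N_def matrix_matrix_mult_def mat_def vec_eq_iff e3 lt inj)
  then have "N ** M = mat 1"
    by (simp add: matrix_left_right_inverse)
  moreover obtain i' j' where ij: "i = e i'" "j = e j'"
  proof -
    have "k \<in> range e" if "k < 3" for k
      using that by (auto simp: e_def image_iff numeral_3_eq_3 less_Suc_eq intro: exI[of _ 1] exI[of _ 2] exI[of _ 3])
    then show ?thesis using that assms(3,4) by blast
  qed
  ultimately have "(N ** M) $ i' $ j' = (if i = j then 1 else 0)"
    by (simp add: mat_def inj)
  then have *: "w i * (\<Sum>a<3. E a i * E a j) = (if i = j then 1 else 0)"
    by (simp add: M_def N_def matrix_matrix_mult_def e3 ij sum_distrib_left mult.assoc)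
  moreover have "w i \<noteq> 0"
  proof
    assume "w i = 0"
    then have "(N ** M) $ i' $ i' = 0"
      by (simp add: M_def N_def matrix_matrix_mult_def ij)
    then show False
      using \<open>N ** M = mat 1\<close> by (simp add: mat_def)
  qed
  ultimately show ?thesis
    by (auto simp: eq_divide_eq mult.commute)
qed

lemma frame_parseval:
  fixes E :: "nat \<Rightarrow> nat \<Rightarrow> real"
  assumes "\<And>i j. i < n \<Longrightarrow> j < n \<Longrightarrow> (\<Sum>a<n. E a i * E a j) = (if i = j then v i else 0)"
  shows "(\<Sum>a<n. (\<Sum>i<n. E a i * u i)\<^sup>2) = (\<Sum>i<n. v i * (u i)\<^sup>2)"
proof -
  have "(\<Sum>a<n. (\<Sum>i<n. E a i * u i)\<^sup>2) = (\<Sum>a<n. \<Sum>i<n. \<Sum>j<n. E a i * E a j * (u i * u j))"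
    by (simp add: power2_eq_square sum_product mult_ac)
  also have "\<dots> = (\<Sum>i<n. \<Sum>j<n. \<Sum>a<n. E a i * E a j * (u i * u j))"
    by (subst sum.swap, rule sum.cong[OF refl], rule sum.swap)
  also have "\<dots> = (\<Sum>i<n. \<Sum>j<n. if i = j then v i * (u i)\<^sup>2 else 0)"
    by (intro sum.cong refl) (auto simp: assms power2_eq_square simp flip: sum_distrib_right)
  finally show ?thesis by simp
qed

text \<open>The sum over pairs \<open>j < k\<close> is half of the sum over all pairs, to which the Parseval
  identity applies in each of the three indices separately.\<close>

lemma cov_deriv_norm_sq_diagonal:
  assumes E: "\<And>i j. i < n \<Longrightarrow> j < n \<Longrightarrow> (\<Sum>a<n. E a i * E a j) = (if i = j then v i else 0)"
    and c: "\<And>i j k. i < n \<Longrightarrow> j < n \<Longrightarrow> k < n \<Longrightarrow> cov_deriv n c G \<omega> p i j k = T i j k"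
    and alt: "\<And>i j k. i < n \<Longrightarrow> j < n \<Longrightarrow> k < n \<Longrightarrow> T i k j = - T i j k"
  shows "2 * cov_deriv_norm_sq n c G \<omega> p E = (\<Sum>i<n. \<Sum>j<n. \<Sum>k<n. v i * v j * v k * (T i j k)\<^sup>2)"
proof -
  define S where "S = (\<lambda>a b d. \<Sum>i<n. E a i * (\<Sum>j<n. E b j * (\<Sum>k<n. E d k * T i j k)))"
  have S: "frame_cov_deriv n c G \<omega> p E a b d = S a b d" for a b d
    by (simp add: frame_cov_deriv_def S_def c sum_distrib_left mult.assoc)
  \<comment> \<open>Antisymmetry carries over to the frame components.\<close>
  have S_alt: "S a d b = - S a b d" for a b d
  proof -
    have "(\<Sum>j<n. E d j * (\<Sum>k<n. E b k * T i j k)) = - (\<Sum>j<n. E b j * (\<Sum>k<n. E d k * T i j k))"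
      if "i < n" for i
    proof -
      have "(\<Sum>j<n. E d j * (\<Sum>k<n. E b k * T i j k)) = (\<Sum>k<n. \<Sum>j<n. E d j * (E b k * T i j k))"
        by (simp add: sum_distrib_left) (rule sum.swap)
      also have "\<dots> = (\<Sum>k<n. \<Sum>j<n. - (E b k * (E d j * T i k j)))"
      proof (intro sum.cong refl)
        show "E d j * (E b k * T i j k) = - (E b k * (E d j * T i k j))"
          if "j \<in> {..<n}" "k \<in> {..<n}" for j k
          using alt[of i k j] that \<open>i < n\<close> by simp
      qed
      finally show ?thesis by (simp add: sum_distrib_left sum_negf)
    qed
    then show ?thesis by (simp add: S_def sum_negf)
  qed
  have half: "(\<Sum>b<m. \<Sum>d<m. g b d) = 2 * (\<Sum>d<m. \<Sum>b<d. g b d)"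
    if "\<And>b d. g b d = g d b" "\<And>b. g b b = 0" for g :: "nat \<Rightarrow> nat \<Rightarrow> real" and m
    by (induction m) (simp_all add: sum.distrib that(2) that(1)[of m for m])
  have "2 * cov_deriv_norm_sq n c G \<omega> p E = (\<Sum>b<n. \<Sum>d<n. \<Sum>a<n. (S a b d)\<^sup>2)"
  proof -
    have "S a b b = 0" for a b using S_alt[of a b b] by linarith
    moreover have "(S a b d)\<^sup>2 = (S a d b)\<^sup>2" for a b d using S_alt[of a b d] by simp
    ultimately show ?thesis
      by (subst half) (simp_all add: cov_deriv_norm_sq_def S)
  qed
  also have "\<dots> = (\<Sum>b<n. \<Sum>d<n. \<Sum>i<n. v i * (\<Sum>j<n. E b j * (\<Sum>k<n. E d k * T i j k))\<^sup>2)"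
    by (simp add: S_def frame_parseval[OF E])
  also have "\<dots> = (\<Sum>i<n. v i * (\<Sum>d<n. \<Sum>b<n. (\<Sum>j<n. E b j * (\<Sum>k<n. E d k * T i j k))\<^sup>2))"
  proof -
    have rotate: "(\<Sum>b<n. \<Sum>d<n. \<Sum>i<n. h i b d) = (\<Sum>i<n. \<Sum>d<n. \<Sum>b<n. h i b d)"
      for h :: "nat \<Rightarrow> nat \<Rightarrow> nat \<Rightarrow> real"
    proof -
      have "(\<Sum>b<n. \<Sum>d<n. \<Sum>i<n. h i b d) = (\<Sum>d<n. \<Sum>b<n. \<Sum>i<n. h i b d)"
        by (rule sum.swap)
      also have "\<dots> = (\<Sum>d<n. \<Sum>i<n. \<Sum>b<n. h i b d)"
        by (intro sum.cong refl sum.swap)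
      also have "\<dots> = (\<Sum>i<n. \<Sum>d<n. \<Sum>b<n. h i b d)"
        by (rule sum.swap)
      finally show ?thesis .
    qed
    show ?thesis
      by (simp only: sum_distrib_left) (rule rotate)
  qed
  also have "\<dots> = (\<Sum>i<n. v i * (\<Sum>d<n. \<Sum>j<n. v j * (\<Sum>k<n. E d k * T i j k)\<^sup>2))"
    by (simp add: frame_parseval[OF E])
  also have "\<dots> = (\<Sum>i<n. v i * (\<Sum>j<n. v j * (\<Sum>d<n. (\<Sum>k<n. E d k * T i j k)\<^sup>2)))"
    by (subst sum.swap) (simp add: sum_distrib_left)
  also have "\<dots> = (\<Sum>i<n. v i * (\<Sum>j<n. v j * (\<Sum>k<n. v k * (T i j k)\<^sup>2)))"
    by (simp add: frame_parseval[OF E])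
  finally show ?thesis by (simp add: sum_distrib_left mult.assoc)
qed

lemma codiff_norm_sq_diagonal:
  assumes E: "\<And>i j. i < n \<Longrightarrow> j < n \<Longrightarrow> (\<Sum>a<n. E a i * E a j) = (if i = j then v i else 0)"
    and c: "\<And>i j k. i < n \<Longrightarrow> j < n \<Longrightarrow> k < n \<Longrightarrow> cov_deriv n c G \<omega> p i j k = T i j k"
  shows "codiff_norm_sq n c G \<omega> p E = (\<Sum>k<n. v k * (\<Sum>i<n. v i * T i i k)\<^sup>2)"
proof -
  have "(\<Sum>a<n. frame_cov_deriv n c G \<omega> p E a a d) = (\<Sum>k<n. E d k * (\<Sum>i<n. v i * T i i k))" for d
  proof -
    have "(\<Sum>a<n. frame_cov_deriv n c G \<omega> p E a a d)
      = (\<Sum>a<n. \<Sum>i<n. \<Sum>j<n. E a i * E a j * (\<Sum>k<n. E d k * T i j k))"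
      by (simp add: frame_cov_deriv_def c sum_distrib_left mult.assoc)
    also have "\<dots> = (\<Sum>i<n. \<Sum>j<n. \<Sum>a<n. E a i * E a j * (\<Sum>k<n. E d k * T i j k))"
      by (subst sum.swap, rule sum.cong[OF refl], rule sum.swap)
    also have "\<dots> = (\<Sum>i<n. \<Sum>j<n. if i = j then v i * (\<Sum>k<n. E d k * T i i k) else 0)"
      by (intro sum.cong refl) (auto simp: E simp flip: sum_distrib_right)
    also have "\<dots> = (\<Sum>i<n. \<Sum>k<n. E d k * (v i * T i i k))"
      by (simp add: sum_distrib_left mult_ac)
    also have "\<dots> = (\<Sum>k<n. \<Sum>i<n. E d k * (v i * T i i k))"
      by (rule sum.swap)
    finally show ?thesis by (simp add: sum_distrib_left)
  qed
  then show ?thesis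
    by (simp add: codiff_norm_sq_def codiff_def frame_parseval[OF E])
qed


section \<open>The example\<close>

text \<open>The metric \<open>e\<^sup>-\<^sup>y dx\<^sup>2 + dy\<^sup>2 + e\<^sup>y dz\<^sup>2\<close> in the coordinates \<open>x = p 0\<close>, \<open>y = p 1\<close>, \<open>z = p 2\<close>.\<close>

definition warped_metric :: "nat \<Rightarrow> nat \<Rightarrow> (nat \<Rightarrow> real) \<Rightarrow> real" where
  "warped_metric i j p = (if i = j then 1 else 0) * exp ((real i - 1) * p 1)"

text \<open>The value of \<open>\<nabla>\<^sub>i\<omega>\<^sub>j\<^sub>k\<close> for \<open>\<omega> = \<lambda>(x) e\<^sup>y dx \<and> dy\<close>, where \<open>h\<close>, \<open>d\<close> and \<open>e\<close> stand for
  \<open>\<lambda>(x)\<close>, \<open>\<lambda>'(x)\<close> and \<open>e\<^sup>y\<close>. The components with indices \<open>(2, 0, 2)\<close> and \<open>(2, 2, 0)\<close> come from the warping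
  alone. They contribute to the codifferential with the same sign as those with
  \<open>(1, 0, 1)\<close> and \<open>(1, 1, 0)\<close>, and this yields the strict inequality.\<close>

definition warped_cov_deriv :: "real \<Rightarrow> real \<Rightarrow> real \<Rightarrow> nat \<Rightarrow> nat \<Rightarrow> nat \<Rightarrow> real" where
  "warped_cov_deriv d h e i j k =
     (if (i, j, k) = (0, 0, 1) then d * e else if (i, j, k) = (0, 1, 0) then - d * e
      else if (i, j, k) = (1, 0, 1) then 3 / 2 * h * e else if (i, j, k) = (1, 1, 0) then - 3 / 2 * h * e
      else if (i, j, k) = (2, 0, 2) then h * e\<^sup>2 / 2 else if (i, j, k) = (2, 2, 0) then - h * e\<^sup>2 / 2
      else 0)"

lemma all_less_3: "(\<forall>i<3. P i) \<longleftrightarrow> P 0 \<and> P 1 \<and> P (2::nat)"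
  by (simp add: eval_nat_numeral All_less_Suc) blast

lemma sum_less_3: "(\<Sum>i<3. h i) = h 0 + h 1 + h (2::nat)" for h :: "nat \<Rightarrow> real"
  by (simp add: eval_nat_numeral)

lemma riemannian_metric_warped:
  assumes U: "openin (Euclidean_space 3) U"
  shows "riemannian_metric 3 {(U, \<lambda>x. x)} (\<lambda>c. warped_metric)"
proof -
  have "smooth_in_chart 3 (U, \<lambda>x. x) (warped_metric i j)" for i j
    unfolding warped_metric_def[abs_def]
    by (rule smooth_in_chart_id[OF U smooth_on_exp_coordinate])
  moreover have "(\<Sum>i<3. \<Sum>j<3. warped_metric i j p * v i * v j) > 0" if "\<exists>i<3. v i \<noteq> 0" for p v :: "nat \<Rightarrow> real"
  proof -
    from that obtain m where m: "m < 3" "v m \<noteq> 0" by blast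
    have "(\<Sum>j<3. warped_metric i j p * v i * v j) = exp ((real i - 1) * p 1) * (v i)\<^sup>2" if "i < 3" for i
    proof -
      have "(\<Sum>j<3. warped_metric i j p * v i * v j)
        = (\<Sum>j<3. if i = j then exp ((real i - 1) * p 1) * (v i)\<^sup>2 else 0)"
        by (rule sum.cong) (auto simp: warped_metric_def power2_eq_square)
      then show ?thesis using that by simp
    qed
    then have "(\<Sum>i<3. \<Sum>j<3. warped_metric i j p * v i * v j)
        = (\<Sum>i<3. exp ((real i - 1) * p 1) * (v i)\<^sup>2)"
      by (intro sum.cong) simp_all
    also have "\<dots> > 0"
      by (rule sum_pos2[of _ m]) (use m in auto)
    finally show ?thesis .
  qed
  moreover have "(\<Sum>k<3. \<Sum>l<3. chart_pdiff (U, \<lambda>x. x) i (\<lambda>q. q k) p *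
      chart_pdiff (U, \<lambda>x. x) j (\<lambda>q. q l) p * warped_metric k l p) = warped_metric i j p"
    if "p \<in> U" "i < 3" "j < 3" for p i j
  proof -
    have "chart_pdiff (U, \<lambda>x. x) i (\<lambda>q. q k) p = (if i = k then 1 else 0)" if "i < 3" for i k
      using chart_pdiff_id[OF U \<open>p \<in> U\<close> that, of "\<lambda>q. q k" "\<lambda>q. q k"] by (simp add: pdiff_coordinate)
    then have "(\<Sum>l<3. chart_pdiff (U, \<lambda>x. x) i (\<lambda>q. q k) p *
        chart_pdiff (U, \<lambda>x. x) j (\<lambda>q. q l) p * warped_metric k l p)
      = (if i = k then warped_metric k j p else 0)" for k
      using that(2,3) by (cases "i = k") (simp_all add: if_distrib[of "\<lambda>x. x * _"] cong: if_cong)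
    then show ?thesis
      using that(2) by simp
  qed
  moreover have "warped_metric i j p = warped_metric j i p" for i j p
    by (simp add: warped_metric_def)
  ultimately show ?thesis
    unfolding riemannian_metric_def by (intro conjI ballI allI impI) auto
qed

lemma pdiff_mult_exp:
  assumes "lam differentiable at (p 0)"
  shows "pdiff i (\<lambda>x. a * lam (x 0) * exp (x 1)) p = a *
    (if i = 0 then deriv lam (p 0) else if i = 1 then lam (p 0) else 0) * exp (p 1)"
proof -
  have "(lam has_field_derivative deriv lam (p 0)) (at (p 0))"
    using assms by (simp add: DERIV_deriv_iff_real_differentiable)
  then have "((\<lambda>t. a * lam t * exp (p 1)) has_field_derivative a * deriv lam (p 0) * exp (p 1)) (at (p 0))"
    by (auto intro!: derivative_eq_intros)
  moreover have "((\<lambda>t. a * lam (p 0) * exp t) has_field_derivative a * lam (p 0) * exp (p 1)) (at (p 1))"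
    by (auto intro!: derivative_eq_intros)
  ultimately show ?thesis
    by (auto simp: pdiff_def DERIV_imp_deriv)
qed

lemma cov_deriv_warped:
  assumes U: "openin (Euclidean_space 3) U" and lam: "\<And>t. lam differentiable at t" and p: "p \<in> U"
    and "i < 3" "j < 3" "k < 3"
  shows "cov_deriv 3 (U, \<lambda>x. x) warped_metric
      (omega_form lam 3 (U, \<lambda>x. x) warped_metric (\<lambda>x. x 0)) p i j k
    = warped_cov_deriv (deriv lam (p 0)) (lam (p 0)) (exp (p 1)) i j k"
proof -
  let ?c = "(U, \<lambda>x :: nat \<Rightarrow> real. x)"
  let ?f = "\<lambda>x :: nat \<Rightarrow> real. x 0"
  \<comment> \<open>the components of \<open>dx \<and> dy\<close>\<close>
  define s :: "nat \<Rightarrow> nat \<Rightarrow> real" where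
    "s = (\<lambda>j k. if j = 0 \<and> k = 1 then 1 else if j = 1 \<and> k = 0 then - 1 else 0)"
  have f: "chart_pdiff ?c i ?f x = (if i = 0 then 1 else 0)" if "x \<in> U" "i < 3" for x i
    using chart_pdiff_id[OF U that, of ?f ?f] by (simp add: pdiff_coordinate)
  have G: "warped_metric i j x = (if i = j then exp ((real i - 1) * x 1) else 0)" for i j x
    by (simp add: warped_metric_def)
  \<comment> \<open>The factors \<open>1\<close> give the right-hand side the shape that the formula for the derivative expects.\<close>
  have grad: "grad_norm_sq 3 ?c warped_metric ?f x = 1 * exp (1 * x 1)" if "x \<in> U" for x
    using that by (subst grad_norm_sq_diagonal[of 3 warped_metric x "\<lambda>i. exp ((real i - 1) * x 1)", OF G])
      (simp_all add: f sum_less_3 exp_minus divide_inverse)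
  have dgrad: "chart_pdiff ?c i (grad_norm_sq 3 ?c warped_metric ?f) x = (if i = 1 then exp (x 1) else 0)"
    if "x \<in> U" "i < 3" for x i
    by (subst chart_pdiff_id[OF U that grad]) (simp_all only: pdiff_exp_coordinate, simp)
  have omega: "omega_form lam 3 ?c warped_metric ?f j k x = s j k * lam (x 0) * exp (x 1)"
    if "x \<in> U" "j < 3" "k < 3" for x j k
    using that by (auto simp: omega_form_def wedge_def f dgrad s_def)
  have domega: "chart_pdiff ?c i (omega_form lam 3 ?c warped_metric ?f j k) p = s j k *
      (if i = 0 then deriv lam (p 0) else if i = 1 then lam (p 0) else 0) * exp (p 1)"
    if "i < 3" "j < 3" "k < 3" for i j k
    by (subst chart_pdiff_id[OF U p that(1) omega[OF _ that(2,3)]]) (simp_all only: pdiff_mult_exp[OF lam])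
  have dG: "chart_pdiff ?c k (warped_metric i j) p
      = (if i = j then (if k = 1 then real i - 1 else 0) * exp ((real i - 1) * p 1) else 0)"
    if "k < 3" for i j k
  proof -
    have "chart_pdiff ?c k (warped_metric i j) p
      = pdiff k (\<lambda>x. (if i = j then 1 else 0) * exp ((real i - 1) * x 1)) p"
      by (rule chart_pdiff_id[OF U p that]) (simp add: warped_metric_def)
    then show ?thesis by (simp only: pdiff_exp_coordinate) simp
  qed
  have LC: "levi_civita 3 ?c warped_metric p = (\<lambda>l i j. if l < 3 \<and> i < 3 \<and> j < 3 then
     ((if l = j then (if i = 1 then real l - 1 else 0) * exp ((real l - 1) * p 1) else 0)
      + (if l = i then (if j = 1 then real l - 1 else 0) * exp ((real l - 1) * p 1) else 0)
      - (if i = j then (if l = 1 then real i - 1 else 0) * exp ((real i - 1) * p 1) else 0))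
       / (2 * exp ((real l - 1) * p 1)) else 0)"
    by (rule levi_civita_diagonal) (simp_all add: G dG)
  have "\<forall>i<3. \<forall>j<3. \<forall>k<3. cov_deriv 3 ?c warped_metric (omega_form lam 3 ?c warped_metric ?f) p i j k
    = warped_cov_deriv (deriv lam (p 0)) (lam (p 0)) (exp (p 1)) i j k"
    unfolding all_less_3 cov_deriv_def
    by (simp add: sum_less_3 domega omega[OF p] LC s_def warped_cov_deriv_def power2_eq_square)
  then show ?thesis using assms(4-6) by simp
qed

theorem mainTheorem1:
  fixes lam :: "real \<Rightarrow> real"
  assumes "smooth_real lam" and "\<exists>t. lam t \<noteq> 0"
  shows "\<exists>(n :: nat) (X :: (nat \<Rightarrow> real) topology) A g f.
    smooth_manifold n X A \<and> topspace X \<noteq> {} \<and>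
    riemannian_metric n A g \<and> smooth_function n A f \<and>
    (\<forall>c\<in>A. \<forall>p\<in>dom_of c. \<forall>E. orthonormal_frame n (g c) p E \<longrightarrow>
       cov_deriv_norm_sq n c (g c) (omega_form lam n c (g c) f) p E
         < codiff_norm_sq n c (g c) (omega_form lam n c (g c) f) p E)"
proof -
  have lam: "lam differentiable at t" for t
    using spec[OF assms(1)[unfolded smooth_real_def], of 0] by simp
  define U where "U = {x \<in> topspace (Euclidean_space 3). lam (x 0) \<in> - {0}}"
  let ?c = "(U, \<lambda>x :: nat \<Rightarrow> real. x)"
  let ?\<omega> = "omega_form lam 3 ?c warped_metric (\<lambda>x. x 0)"
  have U: "openin (Euclidean_space 3) U"
    unfolding U_def
  proof (rule openin_continuous_map_preimage)
    have "continuous_map euclideanreal euclideanreal lam"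
      using lam by (simp add: differentiable_imp_continuous_within continuous_at_imp_continuous_on)
    from continuous_map_compose[OF continuous_map_coordinate[of 3 UNIV 0] this]
    show "continuous_map (Euclidean_space 3) euclideanreal (\<lambda>x. lam (x 0))"
      by (simp add: o_def)
  qed auto
  obtain t where t: "lam t \<noteq> 0" using assms(2) by blast
  have "(\<lambda>i. if i = 0 then t else 0) \<in> U"
    using t by (simp add: U_def topspace_Euclidean_space)
  then have nonempty: "topspace (subtopology (Euclidean_space 3) U) \<noteq> {}"
    using openin_subset[OF U] by auto
  have less: "cov_deriv_norm_sq 3 ?c warped_metric ?\<omega> p E < codiff_norm_sq 3 ?c warped_metric ?\<omega> p E"
    if p: "p \<in> U" and E: "orthonormal_frame 3 warped_metric p E" for p E
  proof -
    define d h e where "d = deriv lam (p 0)" and "h = lam (p 0)" and "e = exp (p 1)"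
    have e: "e > 0" and h: "h \<noteq> 0"
      using p by (auto simp: e_def h_def U_def)
    \<comment> \<open>the diagonal of the inverse metric\<close>
    define v :: "nat \<Rightarrow> real" where "v i = 1 / exp ((real i - 1) * p 1)" for i
    have v: "v 0 = e" "v (Suc 0) = 1" "v 2 = 1 / e"
      by (simp_all add: v_def e_def exp_minus divide_inverse)
    have complete: "(\<Sum>a<3. E a i * E a j) = (if i = j then v i else 0)" if "i < 3" "j < 3" for i j
      using orthonormal_frame_complete[OF E _ that, of "\<lambda>i. exp ((real i - 1) * p 1)"]
      by (simp add: warped_metric_def v_def)
    have cov: "cov_deriv 3 ?c warped_metric ?\<omega> p i j k = warped_cov_deriv d h e i j k"
      if "i < 3" "j < 3" "k < 3" for i j k
      unfolding d_def h_def e_def by (rule cov_deriv_warped[OF U lam p that])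
    have alt: "warped_cov_deriv d h e i k j = - warped_cov_deriv d h e i j k" for i j k
      by (simp add: warped_cov_deriv_def)
    have "2 * cov_deriv_norm_sq 3 ?c warped_metric ?\<omega> p E = 2 * (d\<^sup>2 * e ^ 4) + 5 * (h\<^sup>2 * e ^ 3)"
      using e by (subst cov_deriv_norm_sq_diagonal[OF complete cov alt])
        (simp_all add: sum_less_3 v warped_cov_deriv_def field_simps power2_eq_square power3_eq_cube power4_eq_xxxx)
    moreover have "codiff_norm_sq 3 ?c warped_metric ?\<omega> p E = d\<^sup>2 * e ^ 4 + 4 * (h\<^sup>2 * e ^ 3)"
      using e by (subst codiff_norm_sq_diagonal[OF complete cov])
        (simp_all add: sum_less_3 v warped_cov_deriv_def field_simps power2_eq_square power3_eq_cube power4_eq_xxxx)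
    moreover have "h\<^sup>2 * e ^ 3 > 0"
      using e h by simp
    ultimately show ?thesis by linarith
  qed
  show ?thesis
  proof (intro exI conjI)
    show "smooth_manifold 3 (subtopology (Euclidean_space 3) U) {?c}"
      by (rule smooth_manifold_open_subset[OF U])
    show "riemannian_metric 3 {?c} (\<lambda>c. warped_metric)"
      by (rule riemannian_metric_warped[OF U])
    show "smooth_function 3 {?c} (\<lambda>x. x 0)"
      by (simp add: smooth_function_def smooth_in_chart_id[OF U smooth_on_coordinate])
  qed (use nonempty less in auto)
qed

end
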